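(* Let $(z^j)_{j\ge0}$, $(w_{d_f}^j)$, $(w_{d_g}^j)$, $(x^j)$, $(y^j)$ be generated by relaxed ADMM with parameter $\gamma>0$ and relaxation parameters $(\lambda_j)_{j\ge0}\subset(0,1]$, let $z^\ast$ be a fixed point of $T_{\mathrm{PRS}}$, and let $w^\ast,x^\ast,y^\ast$ be the associated dual and primal solutions. Set $$S_{d_f}(w_{d_f}^k,w^\ast)=\max\Big\{\tfrac{\beta_f\alpha_A}2\|w_{d_f}^k-w^\ast\|^2,\tfrac{\mu_f}{2\|A\|^2}\|Ax^k-Ax^\ast\|^2\Big\},\quad S_{d_g}(w_{d_g}^k,w^\ast)=\max\Big\{\tfrac{\beta_g\alpha_B}2\|w_{d_g}^k-w^\ast\|^2,\tfrac{\mu_g}{2\|B\|^2}\|By^k-By^\ast\|^2\Big\}.$$ Then: 1. (Best iterate convergence) If $(\lambda_j)_{j\ge0}$ is bounded away from zero, then $\min_{i=0,\dots,k}S_{d_f}(w_{d_f}^i,w^\ast)=o(1/(k+1))$ and $\min_{i=0,\dots,k}S_{d_g}(w_{d_g}^i,w^\ast)=o(1/(k+1))$. 2. (Ergodic convergence) Let $\Lambda_k=\sum_{i=0}^k\lambda_i$ and let $\overline w_{d_f}^k,\overline w_{d_g}^k,\overline x^k,\overline y^k$ denote the averages $\frac1{\Lambda_k}\sum_{i=0}^k\lambda_iv^i$ of the sequences $v=w_{d_f},w_{d_g},x,y$, respectively. Then for all $k\ge0$ $$\max\Big\{\beta_f\alpha_A\|\overline w_{d_f}^k-w^\ast\|^2,\tfrac{\mu_f}{\|A\|^2}\|A\overline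 x^k-Ax^\ast\|^2\Big\}+\max\Big\{\beta_g\alpha_B\|\overline w_{d_g}^k-w^\ast\|^2,\tfrac{\mu_g}{\|B\|^2}\|B\overline y^k-By^\ast\|^2\Big\}\le\frac{\|z^0-z^\ast\|^2}{4\gamma\Lambda_k}.$$ 3. (General convergence) If $\inf_{j\ge0}\lambda_j(1-\lambda_j)>0$, then $S_{d_f}(w_{d_f}^k,w^\ast)+S_{d_g}(w_{d_g}^k,w^\ast)=o(1/\sqrt{k+1})$.
   Context: $\mathcal H_1,\mathcal H_2,\mathcal G$ are real Hilbert spaces; $A:\mathcal H_1\to\mathcal G$, $B:\mathcal H_2\to\mathcal G$ are nonzero bounded linear operators; $b\in\mathcal G$; $f:\mathcal H_1\to(-\infty,\infty]$, $g:\mathcal H_2\to(-\infty,\infty]$ are closed, proper, convex. The primal problem is to minimize $f(x)+g(y)$ subject to $Ax+By=b$. With $f^\ast,g^\ast$ the convex conjugates, set $d_f(w)=f^\ast(A^\ast w)$, $d_g(w)=g^\ast(B^\ast w)-\langle w,b\rangle$ on $\mathcal G$. Standing assumptions: there is $w$ with $0\in\partial d_f(w)+\partial d_g(w)$, and the chain rules $\partial d_f(w)=A\,\partial f^\ast(A^\ast w)$, $\partial d_g(w)=B\,\partial g^\ast(B^\ast w)-b$ hold for all $w$. Relaxed ADMM: let $w^{-1}\in\mathcal G$, $x^{-1}=0$, $y^{-1}=0$, $\lambda_{-1}=1/2$. For $k=-1,0,1,\dots$: $y^{k+1}\in\arg\min_y g(y)-\langle w^k,Ax^k+By-b\rangle+\frac\gamma2\|Ax^k+By-b+(2\lambda_k-1)(Ax^k+By^k-b)\|^2$;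 $w^{k+1}=w^k-\gamma(Ax^k+By^{k+1}-b)-\gamma(2\lambda_k-1)(Ax^k+By^k-b)$; $x^{k+1}\in\arg\min_x f(x)-\langle w^{k+1},Ax+By^{k+1}-b\rangle+\frac\gamma2\|Ax+By^{k+1}-b\|^2$. Here the first $\arg\min$ and the $w$-update at $k=-1$ use $2\lambda_{-1}-1=0$. For $k\ge0$ set $w_{d_g}^k=w^k$, $w_{d_f}^k=w^k-\gamma(Ax^k+By^k-b)$; and $z^0=w^{-1}$, $z^{k+1}=z^k+2\lambda_k(w_{d_f}^k-w_{d_g}^k)=z^k-2\gamma\lambda_k(Ax^k+By^k-b)$. Equivalently, $z^{k+1}=(1-\lambda_k)z^k+\lambda_kT_{\mathrm{PRS}}z^k$ with $T_{\mathrm{PRS}}=\mathbf{refl}_{\gamma d_f}\circ\mathbf{refl}_{\gamma d_g}$, $w_{d_g}^k=\mathbf{prox}_{\gamma d_g}(z^k)$, $w_{d_f}^k=\mathbf{prox}_{\gamma d_f}(2w_{d_g}^k-z^k)$, where $\mathbf{prox}_{\gamma h}(w)=\arg\min_v h(v)+\frac1{2\gamma}\|v-w\|^2$ and $\mathbf{refl}_{\gamma h}=2\,\mathbf{prox}_{\gamma h}-I$. Given a fixed point $z^\ast$ of $T_{\mathrm{PRS}}$, $w^\ast=\mathbf{prox}_{\gamma d_g}(z^\ast)$, and $x^\ast,y^\ast$ are points with $A^\ast w^\ast\in\partial f(x^\ast)$, $B^\ast w^\ast\in\partial g(y^\ast)$, $By^\ast-b=\frac1\gamma(z^\ast-w^\ast)$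 and $Ax^\ast=-(By^\ast-b)$. Regularity constants (any may be $0$, meaning no assumption): $f$, $g$ are $\mu_f$-, $\mu_g$-strongly convex; if $\beta_f>0$ (resp. $\beta_g>0$) then $f$ (resp. $g$) is Fréchet differentiable with $(1/\beta_f)$- (resp. $(1/\beta_g)$-) Lipschitz gradient; $\langle AA^\ast w,w\rangle\ge\alpha_A\|w\|^2$ and $\langle BB^\ast w,w\rangle\ge\alpha_B\|w\|^2$ for all $w\in\mathcal G$. *)

theory Defs
  imports "HOL-Analysis.Analysis" "HOL-Library.Landau_Symbols"
begin

text \<open>Functions into \<open>(-\<infinity>, \<infinity>]\<close> are modelled as functions into \<^typ>\<open>ereal\<close> that never take
  the value \<open>-\<infinity>\<close>; the latter is part of properness. Real Hilbert spaces are types of class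
  \<open>{real_inner, complete_space}\<close>.\<close>

definition ext_epigraph :: "('a \<Rightarrow> ereal) \<Rightarrow> ('a \<times> real) set" where
  "ext_epigraph h = {(x, r). h x \<le> ereal r}"

definition proper_fun :: "('a \<Rightarrow> ereal) \<Rightarrow> bool" where
  "proper_fun h \<longleftrightarrow> (\<forall>x. h x \<noteq> -\<infinity>) \<and> (\<exists>x. h x \<noteq> \<infinity>)"

definition closed_fun :: "('a::real_normed_vector \<Rightarrow> ereal) \<Rightarrow> bool" where
  "closed_fun h \<longleftrightarrow> closed (ext_epigraph h)"

definition convex_fun :: "('a::real_normed_vector \<Rightarrow> ereal) \<Rightarrow> bool" where
  "convex_fun h \<longleftrightarrow> convex (ext_epigraph h)"

definition strongly_convex_fun :: "real \<Rightarrow> ('a::real_inner \<Rightarrow> ereal) \<Rightarrow> bool" where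
  "strongly_convex_fun \<mu> h \<longleftrightarrow> convex_fun (\<lambda>x. h x - ereal (\<mu> / 2 * (norm x)\<^sup>2))"

text \<open>Everywhere finite, Frechet differentiable, with an \<open>L\<close>-Lipschitz gradient.\<close>

definition has_lipschitz_gradient :: "real \<Rightarrow> ('a::real_inner \<Rightarrow> ereal) \<Rightarrow> bool" where
  "has_lipschitz_gradient L h \<longleftrightarrow>
     (\<exists>F D. (\<forall>x. h x = ereal (F x)) \<and> (\<forall>x. GDERIV F x :> D x) \<and> L-lipschitz_on UNIV D)"

definition conjugate_fun :: "('a::real_inner \<Rightarrow> ereal) \<Rightarrow> 'a \<Rightarrow> ereal" where
  "conjugate_fun h u = (SUP x. ereal (x \<bullet> u) - h x)"

text \<open>The subdifferential is empty outside the effective domain.\<close>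

definition subdifferential :: "('a::real_inner \<Rightarrow> ereal) \<Rightarrow> 'a \<Rightarrow> 'a set" where
  "subdifferential h x = {u. \<bar>h x\<bar> \<noteq> \<infinity> \<and> (\<forall>y. h x + ereal ((y - x) \<bullet> u) \<le> h y)}"

text \<open>\<open>prox \<gamma> h\<close> is the proximal operator of \<open>\<gamma> h\<close>. For \<open>\<gamma> > 0\<close> and \<open>h\<close> closed, proper and
  convex on a Hilbert space the minimizer exists and is unique, so the choice in
  \<^const>\<open>arg_min\<close> is immaterial.\<close>

definition prox :: "real \<Rightarrow> ('a::real_inner \<Rightarrow> ereal) \<Rightarrow> 'a \<Rightarrow> 'a" where
  "prox \<gamma> h w = arg_min (\<lambda>v. h v + ereal (1 / (2 * \<gamma>) * (norm (v - w))\<^sup>2)) (\<lambda>_. True)"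

definition refl_prox :: "real \<Rightarrow> ('a::real_inner \<Rightarrow> ereal) \<Rightarrow> 'a \<Rightarrow> 'a" where
  "refl_prox \<gamma> h w = 2 *\<^sub>R prox \<gamma> h w - w"

definition T_PRS :: "real \<Rightarrow> ('a::real_inner \<Rightarrow> ereal) \<Rightarrow> ('a \<Rightarrow> ereal) \<Rightarrow> 'a \<Rightarrow> 'a" where
  "T_PRS \<gamma> h1 h2 = refl_prox \<gamma> h1 \<circ> refl_prox \<gamma> h2"

definition dual_f :: "('a::real_inner \<Rightarrow> ereal) \<Rightarrow> ('a \<Rightarrow> 'g::real_inner) \<Rightarrow> 'g \<Rightarrow> ereal" where
  "dual_f f A w = conjugate_fun f (adjoint A w)"

definition dual_g ::
  "('b::real_inner \<Rightarrow> ereal) \<Rightarrow> ('b \<Rightarrow> 'g::real_inner) \<Rightarrow> 'g \<Rightarrow> 'g \<Rightarrow> ereal" where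
  "dual_g g B b w = conjugate_fun g (adjoint B w) - ereal (w \<bullet> b)"

text \<open>One iteration with relaxation parameter \<open>l\<close>, from \<open>(x, y, w)\<close> to \<open>(x', y', w')\<close>. The
  subproblems need not have unique solutions, hence a relation.\<close>

definition admm_step ::
  "('a::real_inner \<Rightarrow> ereal) \<Rightarrow> ('b::real_inner \<Rightarrow> ereal) \<Rightarrow> ('a \<Rightarrow> 'g::real_inner) \<Rightarrow> ('b \<Rightarrow> 'g) \<Rightarrow>
   'g \<Rightarrow> real \<Rightarrow> real \<Rightarrow> 'a \<times> 'b \<times> 'g \<Rightarrow> 'a \<times> 'b \<times> 'g \<Rightarrow> bool" where
  "admm_step f g A B b \<gamma> l = (\<lambda>(x, y, w) (x', y', w').
     is_arg_min
       (\<lambda>v. g v - ereal (w \<bullet> (A x + B v - b))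
          + ereal (\<gamma> / 2 * (norm (A x + B v - b + (2 * l - 1) *\<^sub>R (A x + B y - b)))\<^sup>2))
       (\<lambda>_. True) y' \<and>
     w' = w - \<gamma> *\<^sub>R (A x + B y' - b) - (\<gamma> * (2 * l - 1)) *\<^sub>R (A x + B y - b) \<and>
     is_arg_min
       (\<lambda>u. f u - ereal (w' \<bullet> (A u + B y' - b))
          + ereal (\<gamma> / 2 * (norm (A u + B y' - b))\<^sup>2))
       (\<lambda>_. True) x')"

text \<open>The iteration starts at index \<open>-1\<close>, from \<open>(0, 0, w_init)\<close> with relaxation parameter \<open>1/2\<close>;
  the sequences below hold the iterates of index \<open>0, 1, 2, \<dots>\<close>.\<close>

definition relaxed_admm ::
  "('a::real_inner \<Rightarrow> ereal) \<Rightarrow> ('b::real_inner \<Rightarrow> ereal) \<Rightarrow> ('a \<Rightarrow> 'g::real_inner) \<Rightarrow> ('b \<Rightarrow> 'g) \<Rightarrow>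
   'g \<Rightarrow> real \<Rightarrow> (nat \<Rightarrow> real) \<Rightarrow> 'g \<Rightarrow> (nat \<Rightarrow> 'a) \<Rightarrow> (nat \<Rightarrow> 'b) \<Rightarrow> (nat \<Rightarrow> 'g) \<Rightarrow> bool" where
  "relaxed_admm f g A B b \<gamma> lam w_init x y w \<longleftrightarrow>
     admm_step f g A B b \<gamma> (1 / 2) (0, 0, w_init) (x 0, y 0, w 0) \<and>
     (\<forall>k. admm_step f g A B b \<gamma> (lam k) (x k, y k, w k) (x (Suc k), y (Suc k), w (Suc k)))"

definition S_dual ::
  "real \<Rightarrow> real \<Rightarrow> real \<Rightarrow> ('a::real_inner \<Rightarrow> 'g::real_inner) \<Rightarrow> 'g \<Rightarrow> 'g \<Rightarrow> 'a \<Rightarrow> 'a \<Rightarrow> real" where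
  "S_dual \<beta> \<alpha> \<mu> A w ws x xs =
     max (\<beta> * \<alpha> / 2 * (norm (w - ws))\<^sup>2) (\<mu> / (2 * (onorm A)\<^sup>2) * (norm (A x - A xs))\<^sup>2)"

definition erg_avg :: "(nat \<Rightarrow> real) \<Rightarrow> (nat \<Rightarrow> 'a::real_vector) \<Rightarrow> nat \<Rightarrow> 'a" where
  "erg_avg lam v k = (1 / (\<Sum>i=0..k. lam i)) *\<^sub>R (\<Sum>i=0..k. lam i *\<^sub>R v i)"

end

theory Submission
  imports Defs
begin

text \<open>The optimality conditions of the two subproblems read
  \<open>A\<^sup>* w\<^sub>d\<^sub>f \<in> \<partial>f(x)\<close> and \<open>B\<^sup>* w\<^sub>d\<^sub>g \<in> \<partial>g(y)\<close>, and the governing sequence satisfies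
  \<open>z - w\<^sub>d\<^sub>g = \<gamma> (B y - b)\<close>. Strong monotonicity and cocoercivity of the subdifferentials bound the
  regularity terms by \<open>\<langle>A x - A x\<^sup>*, w\<^sub>d\<^sub>f - w\<^sup>*\<rangle> + \<langle>B y - B y\<^sup>*, w\<^sub>d\<^sub>g - w\<^sup>*\<rangle>\<close>, and this sum is, up to the factor
  \<open>4 \<gamma> \<lambda>\<close>, the decrease of \<open>\<parallel>z - z\<^sup>*\<parallel>\<^sup>2\<close> in one step minus \<open>4 \<lambda> (1 - \<lambda>) \<parallel>w\<^sub>d\<^sub>f - w\<^sub>d\<^sub>g\<parallel>\<^sup>2\<close>. Summation yields
  the best-iterate and (by Jensen) the ergodic rates. For the last rate, the residuals
  \<open>\<parallel>w\<^sub>d\<^sub>f - w\<^sub>d\<^sub>g\<parallel>\<close> are nonincreasing and square summable, and by Cauchy-Schwarz they dominate the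
  regularity terms.\<close>

text \<open>Let \<open>t\<close> decrease to 0. This is how inequalities along a segment, once
  divided by \<open>t\<close>, become first-order conditions below.\<close>

lemma nonneg_if_small_perturbations_nonneg:
  fixes c d :: real
  assumes "\<And>t. 0 < t \<Longrightarrow> t < 1 \<Longrightarrow> 0 \<le> c + t * d"
  shows "0 \<le> c"
proof (rule tendsto_lowerbound)
  show "((\<lambda>t. c + t * d) \<longlongrightarrow> c) (at_right 0)"
    by (auto intro!: tendsto_eq_intros)
  show "\<forall>\<^sub>F t in at_right 0. 0 \<le> c + t * d"
    using assms by (auto simp: eventually_at_right_field intro!: exI[of _ 1])
qed simp

subsection \<open>Adjoints in Hilbert spaces\<close>

text \<open>The direct method: completeness yields a minimizer \<open>u\<close> of the quadratic
  functional \<open>J\<close>, and its first-order condition says that \<open>u\<close> represents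
  \<open>\<phi>\<close>.\<close>

lemma riesz_representation:
  fixes \<phi> :: "'a::{real_inner, complete_space} \<Rightarrow> real"
  assumes "bounded_linear \<phi>"
  shows "\<exists>u. \<forall>x. \<phi> x = x \<bullet> u"
proof -
  interpret bounded_linear \<phi> by fact
  define J where "J x = (norm x)\<^sup>2 / 2 - \<phi> x" for x
  obtain K where K: "\<And>x. norm (\<phi> x) \<le> norm x * K" using bounded by blast
  have lower: "- (K\<^sup>2 / 2) \<le> J x" for x
  proof -
    have "\<phi> x \<le> norm x * K" using K[of x] by simp
    moreover have "0 \<le> (norm x - K)\<^sup>2" by simp
    ultimately show ?thesis unfolding J_def by (simp add: power2_diff)
  qed
  then have bdd: "bdd_below (range J)" by (auto intro!: bdd_belowI)
  define m where "m = (INF x. J x)"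
  have m_le: "m \<le> J x" for x unfolding m_def using bdd by (rule cINF_lower) simp
  have "\<exists>x. J x < m + inverse (real (Suc n))" for n
    using cINF_less_iff[OF _ bdd, of "m + inverse (real (Suc n))"] unfolding m_def by auto
  then obtain X where X: "\<And>n. J (X n) < m + inverse (real (Suc n))" by metis
  \<comment> \<open>Parallelogram law; the linear parts of \<open>J\<close> cancel. Since
    \<open>J\<close> at the midpoint is at least \<open>m\<close>, two nearly minimal points must be
    close.\<close>
  have mid: "(norm (x - y))\<^sup>2 = 4 * (J x + J y - 2 * J ((1/2) *\<^sub>R (x + y)))" for x y
    by (simp add: J_def add scaleR power_mult_distrib power2_norm_eq_inner
        inner_diff_left inner_diff_right inner_add_left inner_add_right inner_commute field_simps)
  have "Cauchy X"
  proof (rule metric_CauchyI)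
    fix e :: real assume "0 < e"
    \<comment> \<open>Values within \<open>e\<^sup>2 / 8\<close> of \<open>m\<close> give a squared
      distance below 4 * 2 * e^2/8 = e^2 in \<open>mid\<close>.\<close>
    then obtain N where N: "inverse (real (Suc N)) < e\<^sup>2 / 8"
      using reals_Archimedean[of "e\<^sup>2 / 8"] by auto
    have "dist (X i) (X j) < e" if "i \<ge> N" "j \<ge> N" for i j
    proof -
      have "inverse (real (Suc k)) \<le> inverse (real (Suc N))" if "k \<ge> N" for k
        using that by (simp add: le_imp_inverse_le)
      then have "J (X i) < m + e\<^sup>2 / 8" "J (X j) < m + e\<^sup>2 / 8"
        using X[of i] X[of j] N that by (smt (verit))+
      then have "(norm (X i - X j))\<^sup>2 < e\<^sup>2"
        using mid[of "X i" "X j"] m_le[of "(1/2) *\<^sub>R (X i + X j)"] by simp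
      then show ?thesis using \<open>0 < e\<close> by (simp add: dist_norm power_less_imp_less_base)
    qed
    then show "\<exists>M. \<forall>i\<ge>M. \<forall>j\<ge>M. dist (X i) (X j) < e" by blast
  qed
  then obtain u where u: "X \<longlonglongrightarrow> u" using Cauchy_convergent convergent_def by blast
  have "(\<lambda>n. J (X n)) \<longlonglongrightarrow> J u"
    unfolding J_def using u by (auto intro!: tendsto_intros tendsto)
  moreover have "(\<lambda>n. m + inverse (real (Suc n))) \<longlonglongrightarrow> m"
    using LIMSEQ_inverse_real_of_nat_add .
  ultimately have "J u \<le> m"
    using X by (intro LIMSEQ_le) (auto intro: less_imp_le)
  then have min: "J u \<le> J v" for v using m_le order_trans by blast
  have ge: "0 \<le> v \<bullet> u - \<phi> v" for v
  proof (rule nonneg_if_small_perturbations_nonneg)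
    fix t :: real assume "0 < t"
    have "0 \<le> J (u + t *\<^sub>R v) - J u" using min by simp
    also have "\<dots> = t * (v \<bullet> u - \<phi> v + t * ((norm v)\<^sup>2 / 2))"
      by (simp add: J_def add scaleR power2_norm_eq_inner inner_add_left inner_add_right
          inner_commute field_simps)
    finally show "0 \<le> v \<bullet> u - \<phi> v + t * ((norm v)\<^sup>2 / 2)"
      using \<open>0 < t\<close> by (simp add: zero_le_mult_iff)
  qed
  have "\<phi> v = v \<bullet> u" for v
    using ge[of v] ge[of "- v"] by (simp add: neg)
  then show ?thesis by blast
qed

text \<open>\<open>adjoint\<close> is a choice among maps with this property, so it suffices that
  one exists; the Riesz theorem supplies its values pointwise.\<close>

lemma adjoint_works_hilbert:
  fixes A :: "'a::{real_inner, complete_space} \<Rightarrow> 'g::real_inner"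
  assumes "bounded_linear A"
  shows "v \<bullet> adjoint A w = A v \<bullet> w"
proof -
  have "\<exists>u. \<forall>v. A v \<bullet> w = v \<bullet> u" for w
    using riesz_representation[OF bounded_linear_compose[OF bounded_linear_inner_left assms]]
    by simp
  then have "\<exists>A'. \<forall>v w. A v \<bullet> w = v \<bullet> A' w" by metis
  then have "\<forall>v w. A v \<bullet> w = v \<bullet> adjoint A w"
    unfolding adjoint_def by (rule someI_ex)
  then show ?thesis by simp
qed

lemma adjoint_diff_hilbert:
  fixes A :: "'a::{real_inner, complete_space} \<Rightarrow> 'g::real_inner"
  assumes "bounded_linear A"
  shows "adjoint A (v - w) = adjoint A v - adjoint A w"
  by (rule vector_eq_rdot[THEN iffD1])
    (simp add: adjoint_works_hilbert[OF assms] inner_diff_right inner_commute)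

subsection \<open>Subgradients\<close>

text \<open>Real upper bounds \<open>r\<close>, \<open>s\<close> replace the values of
  \<open>h\<close>, which keeps infinities out of the convex combination.\<close>

lemma convex_funD:
  assumes "convex_fun h" "h x \<le> ereal r" "h y \<le> ereal s" "0 \<le> t" "t \<le> 1"
  shows "h (x + t *\<^sub>R (y - x)) \<le> ereal ((1 - t) * r + t * s)"
proof -
  have "convex (ext_epigraph h)" using assms(1) unfolding convex_fun_def .
  then have "(1 - t) *\<^sub>R (x, r) + t *\<^sub>R (y, s) \<in> ext_epigraph h"
    by (rule convexD_alt) (use assms in \<open>auto simp: ext_epigraph_def\<close>)
  then show ?thesis
    by (simp add: ext_epigraph_def algebra_simps)
qed

lemma subdifferentialE:
  assumes "u \<in> subdifferential h x"
  obtains r where "h x = ereal r" and "\<And>y. ereal (r + (y - x) \<bullet> u) \<le> h y"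
proof -
  obtain r where r: "h x = ereal r"
    using assms unfolding subdifferential_def by (cases "h x") auto
  moreover have "ereal (r + (y - x) \<bullet> u) \<le> h y" for y
    using assms r unfolding subdifferential_def by (simp flip: plus_ereal.simps(1))
  ultimately show thesis using that by blast
qed

text \<open>Compare the convexity of \<open>h\<close> minus its quadratic with the subgradient
  inequality at a point of the segment from \<open>x\<close> to \<open>y\<close>, divide by
  \<open>t\<close> and let \<open>t\<close> tend to 0.\<close>

lemma strongly_convex_subgradient_le:
  assumes sc: "strongly_convex_fun \<mu> h" and u: "u \<in> subdifferential h x"
    and r: "h x = ereal r" and s: "h y = ereal s"
  shows "r + (y - x) \<bullet> u + \<mu> / 2 * (norm (y - x))\<^sup>2 \<le> s"
proof -
  have "0 \<le> (s - r - (y - x) \<bullet> u - \<mu> / 2 * (norm (y - x))\<^sup>2) + t * (\<mu> / 2 * (norm (y - x))\<^sup>2)"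
    if t: "0 < t" "t < 1" for t
  proof -
    let ?p = "x + t *\<^sub>R (y - x)"
    have "h ?p - ereal (\<mu> / 2 * (norm ?p)\<^sup>2)
        \<le> ereal ((1 - t) * (r - \<mu> / 2 * (norm x)\<^sup>2) + t * (s - \<mu> / 2 * (norm y)\<^sup>2))"
      using sc[unfolded strongly_convex_fun_def] by (rule convex_funD) (use t r s in auto)
    moreover have "ereal (r + (?p - x) \<bullet> u) \<le> h ?p"
      using u r by (elim subdifferentialE) (metis ereal.inject)
    ultimately have "r + t * ((y - x) \<bullet> u) - \<mu> / 2 * (norm ?p)\<^sup>2
        \<le> (1 - t) * (r - \<mu> / 2 * (norm x)\<^sup>2) + t * (s - \<mu> / 2 * (norm y)\<^sup>2)"
      by (cases "h ?p") auto
    moreover have "\<mu> / 2 * (norm ?p)\<^sup>2 = \<mu> / 2 * ((1 - t) * (norm x)\<^sup>2 + t * (norm y)\<^sup>2 - t * (1 - t) * (norm (y - x))\<^sup>2)"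
      by (simp add: power2_norm_eq_inner inner_add_left inner_add_right inner_diff_left
          inner_diff_right inner_commute algebra_simps)
    ultimately have "0 \<le> t * ((s - r - (y - x) \<bullet> u - \<mu> / 2 * (norm (y - x))\<^sup>2)
        + t * (\<mu> / 2 * (norm (y - x))\<^sup>2))"
      by (simp add: field_simps)
    then show ?thesis using t by (simp add: zero_le_mult_iff)
  qed
  then have "0 \<le> s - r - (y - x) \<bullet> u - \<mu> / 2 * (norm (y - x))\<^sup>2"
    by (rule nonneg_if_small_perturbations_nonneg)
  then show ?thesis by simp
qed

lemma subdifferential_strongly_monotone:
  assumes "strongly_convex_fun \<mu> h" "u \<in> subdifferential h x" "v \<in> subdifferential h y"
  shows "\<mu> * (norm (x - y))\<^sup>2 \<le> (x - y) \<bullet> (u - v)"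
proof -
  obtain r s where rs: "h x = ereal r" "h y = ereal s"
    using assms(2,3) by (meson subdifferentialE)
  show ?thesis
    using strongly_convex_subgradient_le[OF assms(1,2) rs]
      strongly_convex_subgradient_le[OF assms(1,3) rs(2,1)]
    by (simp add: norm_minus_commute inner_diff_left inner_diff_right)
qed

text \<open>Along the segment, \<open>\<phi>\<close> is \<open>F\<close> minus the variable part of
  the claimed quadratic bound; the Lipschitz condition makes its derivative nonpositive on
  [0,1].\<close>

lemma lipschitz_gradient_descent:
  fixes F :: "'a::real_inner \<Rightarrow> real"
  assumes D: "\<And>x. GDERIV F x :> D x" and L: "L-lipschitz_on UNIV D"
  shows "F y \<le> F x + (y - x) \<bullet> D x + L / 2 * (norm (y - x))\<^sup>2"
proof -
  define d where "d = y - x"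
  define \<phi> where "\<phi> t = F (x + t *\<^sub>R d) - t * (d \<bullet> D x) - L / 2 * t\<^sup>2 * (norm d)\<^sup>2" for t
  have deriv: "(\<phi> has_real_derivative d \<bullet> D (x + t *\<^sub>R d) - d \<bullet> D x - L * t * (norm d)\<^sup>2) (at t)" for t
  proof -
    have "((\<lambda>t. F (x + t *\<^sub>R d)) has_derivative (\<lambda>h. (h *\<^sub>R d) \<bullet> D (x + t *\<^sub>R d))) (at t)"
      by (rule has_derivative_compose[where f = "\<lambda>t. x + t *\<^sub>R d" and g = F])
        (use D in \<open>auto simp: gderiv_def intro!: derivative_eq_intros\<close>)
    then have "((\<lambda>t. F (x + t *\<^sub>R d)) has_real_derivative d \<bullet> D (x + t *\<^sub>R d)) (at t)"
      by (rule has_derivative_imp_has_field_derivative) (simp add: mult.commute)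
    then show ?thesis
      unfolding \<phi>_def by (auto intro!: derivative_eq_intros simp: field_simps)
  qed
  have "\<phi> 1 \<le> \<phi> 0"
  proof (rule DERIV_nonpos_imp_nonincreasing[of 0 1 \<phi>])
    fix t :: real assume t: "0 \<le> t" "t \<le> 1"
    have "d \<bullet> D (x + t *\<^sub>R d) - d \<bullet> D x = d \<bullet> (D (x + t *\<^sub>R d) - D x)"
      by (simp add: inner_diff_right)
    also have "\<dots> \<le> norm d * norm (D (x + t *\<^sub>R d) - D x)" by (rule norm_cauchy_schwarz)
    also have "\<dots> \<le> norm d * (L * norm (t *\<^sub>R d))"
      using lipschitz_onD[OF L, of "x + t *\<^sub>R d" x] by (intro mult_left_mono) (auto simp: dist_norm)
    also have "\<dots> = L * t * (norm d)\<^sup>2" using t by (simp add: power2_eq_square)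
    finally show "\<exists>y. (\<phi> has_real_derivative y) (at t) \<and> y \<le> 0"
      using deriv[of t] by (intro exI conjI) auto
  qed simp
  then show ?thesis by (simp add: \<phi>_def d_def)
qed

text \<open>Subtracting the linear functional of \<open>u\<close> from \<open>F\<close> leaves a
  function minimal at \<open>x\<close>, whose derivative there must vanish.\<close>

lemma subgradient_eq_gradient:
  assumes h: "\<And>x. h x = ereal (F x)" and D: "GDERIV F x :> D" and u: "u \<in> subdifferential h x"
  shows "u = D"
proof -
  have "((\<lambda>y. F y - y \<bullet> u) has_derivative (\<lambda>d. d \<bullet> D - d \<bullet> u)) (at x)"
    using D unfolding gderiv_def by (auto intro!: derivative_eq_intros)
  moreover have "F x - x \<bullet> u \<le> F y - y \<bullet> u" for y
    using u h by (auto elim!: subdifferentialE simp: inner_diff_left algebra_simps)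
  ultimately have "(\<lambda>d. d \<bullet> D - d \<bullet> u) = (\<lambda>d. 0)"
    by (intro differential_zero_maxmin[of x UNIV]) auto
  then have "d \<bullet> D = d \<bullet> u" for d by (metis eq_iff_diff_eq_0)
  then show ?thesis by (metis vector_eq_rdot inner_commute)
qed

text \<open>The Baillon-Haddad inequality. Apply the subgradient inequality at \<open>x\<close> and
  the descent inequality at \<open>y\<close> to one common test point, then add the result to its
  mirror image.\<close>

lemma subdifferential_cocoercive:
  assumes \<beta>: "\<beta> > 0" and h: "has_lipschitz_gradient (1 / \<beta>) h"
    and u: "u \<in> subdifferential h x" and v: "v \<in> subdifferential h y"
  shows "\<beta> * (norm (u - v))\<^sup>2 \<le> (x - y) \<bullet> (u - v)"
proof -
  obtain F D where F: "\<And>x. h x = ereal (F x)" and D: "\<And>x. GDERIV F x :> D x"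
    and L: "(1 / \<beta>)-lipschitz_on UNIV D"
    using h unfolding has_lipschitz_gradient_def by blast
  have key: "F x + (y - x) \<bullet> u + \<beta> / 2 * (norm (u - v))\<^sup>2 \<le> F y"
    if u: "u \<in> subdifferential h x" and v: "v \<in> subdifferential h y" for x y u v
  proof -
    \<comment> \<open>This point minimizes the quadratic upper bound at \<open>y\<close> of
      \<open>F\<close> minus the linear functional of \<open>u\<close>: a gradient step of length
      \<open>\<beta>\<close>.\<close>
    let ?p = "y - \<beta> *\<^sub>R (v - u)"
    have "F x + (?p - x) \<bullet> u \<le> F ?p"
      using u F by (auto elim!: subdifferentialE)
    also have "\<dots> \<le> F y + (?p - y) \<bullet> v + 1 / \<beta> / 2 * (norm (?p - y))\<^sup>2"
      using lipschitz_gradient_descent[OF D L, of ?p y] subgradient_eq_gradient[OF F D v] by simp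
    also have "1 / \<beta> / 2 * (norm (?p - y))\<^sup>2 = \<beta> / 2 * (norm (u - v))\<^sup>2"
      using \<beta> by (simp add: power_mult_distrib norm_minus_commute power2_eq_square)
    finally have "F x + (?p - x) \<bullet> u \<le> F y + (?p - y) \<bullet> v + \<beta> / 2 * (norm (u - v))\<^sup>2" .
    moreover have "(?p - x) \<bullet> u = (y - x) \<bullet> u - \<beta> * ((v - u) \<bullet> u)"
      and "(?p - y) \<bullet> v = - \<beta> * ((v - u) \<bullet> v)"
      by (simp_all add: inner_diff_left algebra_simps)
    moreover have "\<beta> * (norm (u - v))\<^sup>2 = \<beta> * ((v - u) \<bullet> v) - \<beta> * ((v - u) \<bullet> u)"
      by (simp add: power2_norm_eq_inner inner_diff_left inner_diff_right inner_commute algebra_simps)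
    ultimately show ?thesis by linarith
  qed
  show ?thesis
    using key[OF u v] key[OF v u]
    by (simp add: norm_minus_commute inner_diff_left inner_diff_right)
qed

text \<open>Fermat's rule for a convex function plus a quadratic \<open>\<phi>\<close>. The
  expansion hypothesis encodes that \<open>\<phi>\<close> has gradient \<open>- u\<close> at
  \<open>x\<close>, with remainder exactly quadratic in \<open>t\<close>.\<close>

lemma arg_min_subgradient:
  fixes \<phi> :: "'a::real_inner \<Rightarrow> real"
  assumes h: "convex_fun h" "proper_fun h"
    and min: "is_arg_min (\<lambda>v. h v + ereal (\<phi> v)) (\<lambda>_. True) x"
    and \<phi>: "\<And>t d. \<phi> (x + t *\<^sub>R d) = \<phi> x - t * (d \<bullet> u) + t\<^sup>2 * q d"
  shows "u \<in> subdifferential h x"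
proof -
  have le: "h x + ereal (\<phi> x) \<le> h v + ereal (\<phi> v)" for v
    using min by (auto simp: is_arg_min_def not_less)
  \<comment> \<open>Comparison with a point of finite value forces \<open>h x\<close> to be
    finite.\<close>
  obtain v0 where "h v0 \<noteq> \<infinity>" using h(2) by (auto simp: proper_fun_def)
  then obtain r where r: "h x = ereal r"
    using le[of v0] h(2) by (cases "h x"; cases "h v0") (auto simp: proper_fun_def)
  have "ereal (r + (v - x) \<bullet> u) \<le> h v" for v
  proof (cases "h v")
    case (real s)
    have "0 \<le> (s - r - (v - x) \<bullet> u) + t * q (v - x)" if t: "0 < t" "t < 1" for t
    proof -
      let ?p = "x + t *\<^sub>R (v - x)"
      have "h ?p \<le> ereal ((1 - t) * r + t * s)"
        using h(1) by (rule convex_funD) (use t r real in auto)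
      then have "r + \<phi> x \<le> (1 - t) * r + t * s + \<phi> ?p"
        using le[of ?p] r by (cases "h ?p") auto
      then have "0 \<le> t * ((s - r - (v - x) \<bullet> u) + t * q (v - x))"
        unfolding \<phi> by (simp add: algebra_simps power2_eq_square)
      then show ?thesis using t by (simp add: zero_le_mult_iff)
    qed
    then have "0 \<le> s - r - (v - x) \<bullet> u" by (rule nonneg_if_small_perturbations_nonneg)
    then show ?thesis using real by simp
  qed (use h(2) in \<open>auto simp: proper_fun_def\<close>)
  then show ?thesis using r by (auto simp: subdifferential_def)
qed

text \<open>Covers both subproblems: \<open>c\<close> collects the terms fixed during the
  minimization, and \<open>s\<close> is the over-relaxation shift, present only in the
  penalty.\<close>

lemma augmented_lagrangian_subgradient:
  fixes A :: "'a::{real_inner, complete_space} \<Rightarrow> 'g::real_inner"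
  assumes A: "bounded_linear A" and h: "convex_fun h" "proper_fun h"
    and min: "is_arg_min (\<lambda>v. h v - ereal (w \<bullet> (A v + c)) + ereal (\<gamma> / 2 * (norm (A v + c + s))\<^sup>2))
      (\<lambda>_. True) x"
  shows "adjoint A (w - \<gamma> *\<^sub>R (A x + c + s)) \<in> subdifferential h x"
proof (rule arg_min_subgradient[OF h])
  interpret bounded_linear A by fact
  let ?\<phi> = "\<lambda>v. \<gamma> / 2 * (norm (A v + c + s))\<^sup>2 - w \<bullet> (A v + c)"
  have "h v - ereal (w \<bullet> (A v + c)) + ereal (\<gamma> / 2 * (norm (A v + c + s))\<^sup>2) = h v + ereal (?\<phi> v)" for v
    by (cases "h v") auto
  then show "is_arg_min (\<lambda>v. h v + ereal (?\<phi> v)) (\<lambda>_. True) x" using min by simp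
  show "?\<phi> (x + t *\<^sub>R d) = ?\<phi> x - t * (d \<bullet> adjoint A (w - \<gamma> *\<^sub>R (A x + c + s)))
      + t\<^sup>2 * (\<gamma> / 2 * (norm (A d))\<^sup>2)" for t d
    unfolding power2_norm_eq_inner adjoint_works_hilbert[OF A]
    by (simp add: add scaleR inner_add_left inner_add_right inner_diff_left inner_diff_right
        inner_commute power2_eq_square field_simps)
qed

text \<open>One entry of the maximum comes from strong monotonicity and the operator norm bound for
  \<open>A\<close>, the other from cocoercivity and the lower bound on \<open>adjoint A\<close>. The
  factor 2 cancels the halves in \<open>S_dual\<close>.\<close>

lemma S_dual_le_inner:
  fixes A :: "'a::{real_inner, complete_space} \<Rightarrow> 'g::real_inner"
  assumes A: "bounded_linear A" "A \<noteq> (\<lambda>_. 0)"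
    and \<mu>: "\<mu> \<ge> 0" "strongly_convex_fun \<mu> h"
    and \<beta>: "\<beta> \<ge> 0" "\<beta> > 0 \<Longrightarrow> has_lipschitz_gradient (1 / \<beta>) h"
    and \<alpha>: "\<And>v. A (adjoint A v) \<bullet> v \<ge> \<alpha> * (norm v)\<^sup>2"
    and w: "adjoint A w \<in> subdifferential h x" and w': "adjoint A w' \<in> subdifferential h x'"
  shows "2 * S_dual \<beta> \<alpha> \<mu> A w w' x x' \<le> (A x - A x') \<bullet> (w - w')"
proof -
  interpret bounded_linear A by fact
  have ip: "(x - x') \<bullet> (adjoint A w - adjoint A w') = (A x - A x') \<bullet> (w - w')"
    by (simp flip: adjoint_diff_hilbert[OF A(1)] add: adjoint_works_hilbert[OF A(1)] diff)
  have mono: "\<mu> * (norm (x - x'))\<^sup>2 \<le> (A x - A x') \<bullet> (w - w')"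
    using subdifferential_strongly_monotone[OF \<mu>(2) w w'] ip by simp
  have pos: "onorm A > 0" using onorm_pos_lt[OF A(1)] A(2) by auto
  have "(norm (A x - A x'))\<^sup>2 \<le> (onorm A * norm (x - x'))\<^sup>2"
    using onorm[OF A(1), of "x - x'"] by (intro power_mono) (auto simp: diff)
  then have "(norm (A x - A x'))\<^sup>2 / (onorm A)\<^sup>2 \<le> (norm (x - x'))\<^sup>2"
    using pos by (simp add: power_mult_distrib field_simps)
  from mult_left_mono[OF this \<mu>(1)] mono
  have "\<mu> / (onorm A)\<^sup>2 * (norm (A x - A x'))\<^sup>2 \<le> (A x - A x') \<bullet> (w - w')"
    by simp
  moreover have "\<beta> * \<alpha> * (norm (w - w'))\<^sup>2 \<le> (A x - A x') \<bullet> (w - w')"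
  proof (cases "\<beta> > 0")
    case True
    have "\<alpha> * (norm (w - w'))\<^sup>2 \<le> (norm (adjoint A (w - w')))\<^sup>2"
      using \<alpha>[of "w - w'"] by (simp add: power2_norm_eq_inner flip: adjoint_works_hilbert[OF A(1)])
    then have "\<beta> * (\<alpha> * (norm (w - w'))\<^sup>2) \<le> \<beta> * (norm (adjoint A (w - w')))\<^sup>2"
      using \<beta>(1) by (rule mult_left_mono)
    also have "\<dots> \<le> (A x - A x') \<bullet> (w - w')"
      using subdifferential_cocoercive[OF True \<beta>(2)[OF True] w w'] ip
      by (simp add: adjoint_diff_hilbert[OF A(1)])
    finally show ?thesis by (simp add: mult.assoc)
  next
    \<comment> \<open>Here \<open>\<beta>\<close> is 0, and plain monotonicity is enough.\<close>
    case False
    then have "0 \<le> (A x - A x') \<bullet> (w - w')"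
      using mono \<mu>(1) by (meson mult_nonneg_nonneg order_trans zero_le_power2)
    then show ?thesis using False \<beta>(1) by simp
  qed
  ultimately show ?thesis by (simp add: S_dual_def)
qed

lemma S_dual_nonneg: "0 \<le> \<mu> \<Longrightarrow> 0 \<le> S_dual \<beta> \<alpha> \<mu> A w w' x x'"
  by (simp add: S_dual_def le_max_iff_disj)

subsection \<open>Sequences\<close>

text \<open>The block of indices from \<open>n div 2\<close> to \<open>n\<close> has at least
  (n+1)/2 terms, each at least \<open>a n\<close>, while its sum tends to 0 as a difference of
  partial sums.\<close>

lemma decseq_summable_smallo:
  fixes a :: "nat \<Rightarrow> real"
  assumes "decseq a" "\<And>n. 0 \<le> a n" "summable a"
  shows "a \<in> o(\<lambda>n. 1 / (real n + 1))"
proof -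
  let ?S = "\<lambda>n. \<Sum>i<n. a i"
  have S: "?S \<longlonglongrightarrow> suminf a" using assms(3) by (rule summable_LIMSEQ)
  have half: "filterlim (\<lambda>n::nat. n div 2) sequentially sequentially"
    by (rule filterlim_at_top_div_const_nat) simp
  have "(\<lambda>n. 2 * (?S (Suc n) - ?S (n div 2))) \<longlonglongrightarrow> 2 * (suminf a - suminf a)"
    using LIMSEQ_Suc[OF S] filterlim_compose[OF S half] by (intro tendsto_intros)
  then have lim: "(\<lambda>n. 2 * (?S (Suc n) - ?S (n div 2))) \<longlonglongrightarrow> 0" by simp
  have bound: "a n * (real n + 1) \<le> 2 * (?S (Suc n) - ?S (n div 2))" for n
  proof -
    have "real (card {n div 2..<Suc n}) * a n \<le> (\<Sum>i\<in>{n div 2..<Suc n}. a i)"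
      using assms(1) by (intro sum_bounded_below) (auto simp: decseq_def)
    also have "\<dots> = ?S (Suc n) - ?S (n div 2)"
      using sum_diff_nat_ivl[of 0 "n div 2" "Suc n" a] by (simp add: atLeast0LessThan)
    finally have "real (Suc n - n div 2) * a n \<le> ?S (Suc n) - ?S (n div 2)"
      unfolding card_atLeastLessThan .
    from mult_left_mono[OF this, of 2]
    have "2 * real (Suc n - n div 2) * a n \<le> 2 * (?S (Suc n) - ?S (n div 2))"
      by (simp only: mult.assoc)
    moreover have "(real n + 1) * a n \<le> 2 * real (Suc n - n div 2) * a n"
      using assms(2) by (intro mult_right_mono) linarith+
    ultimately show ?thesis by (simp add: mult.commute)
  qed
  have "(\<lambda>n. a n * (real n + 1)) \<longlonglongrightarrow> 0"
    using lim by (rule tendsto_sandwich[rotated 3]) (use assms(2) bound in auto)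
  then show ?thesis
    by (intro smalloI_tendsto) (auto simp: field_simps)
qed

text \<open>The running minimum is decreasing and inherits summability from
  \<open>a\<close>.\<close>

lemma Min_summable_smallo:
  fixes a :: "nat \<Rightarrow> real"
  assumes "\<And>n. 0 \<le> a n" "summable a"
  shows "(\<lambda>k. MIN i\<in>{0..k}. a i) \<in> o(\<lambda>k. 1 / (real k + 1))"
proof (rule decseq_summable_smallo)
  show "decseq (\<lambda>k. MIN i\<in>{0..k}. a i)"
    by (auto simp: decseq_def intro!: Min_antimono image_mono)
  show nonneg: "0 \<le> (MIN i\<in>{0..k}. a i)" for k using assms(1) by simp
  have "(MIN i\<in>{0..k}. a i) \<le> a k" for k by (intro Min_le) auto
  then show "summable (\<lambda>k. MIN i\<in>{0..k}. a i)"
    using nonneg by (intro summable_comparison_test'[OF assms(2)]) simp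
qed

text \<open>Jensen's inequality for the squared norm: expand each term around the weighted mean
  \<open>?m\<close>, drop the squared deviations, and note that the weighted cross terms sum to
  0.\<close>

lemma norm_erg_avg_diff_le:
  fixes v :: "nat \<Rightarrow> 'a::real_inner"
  assumes "\<And>i. 0 < lam i"
  shows "(norm (erg_avg lam v k - c))\<^sup>2 \<le> (\<Sum>i=0..k. lam i * (norm (v i - c))\<^sup>2) / (\<Sum>i=0..k. lam i)"
proof -
  let ?\<Lambda> = "\<Sum>i=0..k. lam i"
  let ?m = "erg_avg lam v k"
  have pos: "?\<Lambda> > 0" using assms by (intro sum_pos) auto
  then have m: "(\<Sum>i=0..k. lam i *\<^sub>R v i) = ?\<Lambda> *\<^sub>R ?m" by (simp add: erg_avg_def)
  have "(norm (v i - c))\<^sup>2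
      = (norm (?m - c))\<^sup>2 + 2 * ((v i - ?m) \<bullet> (?m - c)) + (norm (v i - ?m))\<^sup>2" for i
    by (simp add: power2_norm_eq_inner inner_diff_left inner_diff_right inner_commute)
  then have "lam i * ((norm (?m - c))\<^sup>2 + 2 * ((v i - ?m) \<bullet> (?m - c))) \<le> lam i * (norm (v i - c))\<^sup>2" for i
    using assms[of i] by simp
  then have "lam i * (norm (?m - c))\<^sup>2 + 2 * ((lam i *\<^sub>R v i - lam i *\<^sub>R ?m) \<bullet> (?m - c))
      \<le> lam i * (norm (v i - c))\<^sup>2" for i
    by (simp add: distrib_left mult.left_commute flip: scaleR_diff_right)
  then have "(\<Sum>i=0..k. lam i * (norm (?m - c))\<^sup>2 + 2 * ((lam i *\<^sub>R v i - lam i *\<^sub>R ?m) \<bullet> (?m - c)))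
      \<le> (\<Sum>i=0..k. lam i * (norm (v i - c))\<^sup>2)"
    by (rule sum_mono)
  also have "(\<Sum>i=0..k. lam i * (norm (?m - c))\<^sup>2 + 2 * ((lam i *\<^sub>R v i - lam i *\<^sub>R ?m) \<bullet> (?m - c)))
      = ?\<Lambda> * (norm (?m - c))\<^sup>2 + 2 * (((\<Sum>i=0..k. lam i *\<^sub>R v i) - ?\<Lambda> *\<^sub>R ?m) \<bullet> (?m - c))"
    unfolding sum.distrib sum_distrib_left[symmetric] sum_distrib_right[symmetric]
      inner_sum_left[symmetric] sum_subtractf scaleR_sum_left[symmetric] ..
  finally show ?thesis using pos m by (simp add: field_simps)
qed

lemma bounded_linear_erg_avg:
  assumes "bounded_linear A"
  shows "A (erg_avg lam v k) = erg_avg lam (\<lambda>i. A (v i)) k"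
proof -
  interpret bounded_linear A by fact
  show ?thesis by (simp add: erg_avg_def scaleR sum)
qed

lemma max_erg_avg_le:
  fixes A :: "'a::real_inner \<Rightarrow> 'g::real_inner"
  assumes "bounded_linear A" "\<And>i. 0 < lam i" "0 \<le> \<beta>" "0 \<le> \<alpha>" "0 \<le> \<mu>"
  shows "max (\<beta> * \<alpha> * (norm (erg_avg lam w k - w'))\<^sup>2)
             (\<mu> / (onorm A)\<^sup>2 * (norm (A (erg_avg lam x k) - A x'))\<^sup>2)
    \<le> (\<Sum>i=0..k. lam i * (2 * S_dual \<beta> \<alpha> \<mu> A (w i) w' (x i) x')) / (\<Sum>i=0..k. lam i)"
proof -
  have pos: "(\<Sum>i=0..k. lam i) > 0" using assms(2) by (intro sum_pos) auto
  \<comment> \<open>Stated for a generic constant and sequence, so that it serves both entries of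
    the maximum.\<close>
  have avg: "C * (norm (erg_avg lam v k - c))\<^sup>2
      \<le> (\<Sum>i=0..k. lam i * (2 * S_dual \<beta> \<alpha> \<mu> A (w i) w' (x i) x')) / (\<Sum>i=0..k. lam i)"
    if "0 \<le> C" and le: "\<And>i. C * (norm (v i - c))\<^sup>2 \<le> 2 * S_dual \<beta> \<alpha> \<mu> A (w i) w' (x i) x'"
    for C :: real and v :: "nat \<Rightarrow> 'g" and c
  proof -
    have "C * (norm (erg_avg lam v k - c))\<^sup>2
        \<le> C * ((\<Sum>i=0..k. lam i * (norm (v i - c))\<^sup>2) / (\<Sum>i=0..k. lam i))"
      using norm_erg_avg_diff_le[of lam, OF assms(2)] that(1) by (rule mult_left_mono)
    also have "\<dots> = (\<Sum>i=0..k. lam i * (C * (norm (v i - c))\<^sup>2)) / (\<Sum>i=0..k. lam i)"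
      by (simp add: sum_distrib_left mult.left_commute)
    also have "\<dots> \<le> (\<Sum>i=0..k. lam i * (2 * S_dual \<beta> \<alpha> \<mu> A (w i) w' (x i) x')) / (\<Sum>i=0..k. lam i)"
      using pos le assms(2) by (intro divide_right_mono sum_mono mult_left_mono) (auto intro: less_imp_le)
    finally show ?thesis .
  qed
  show ?thesis
    unfolding bounded_linear_erg_avg[OF assms(1)]
    by (intro max.boundedI avg) (use assms in \<open>auto simp: S_dual_def field_simps\<close>)
qed

subsection \<open>Peaceman-Rachford steps\<close>

text \<open>In the applications \<open>d\<close>, \<open>e\<close>, \<open>p\<close> are differences
  of governing points, of \<open>wdg\<close> and of \<open>wdf\<close>; then
  \<open>2 *\<^sub>R e - p - d\<close> and \<open>d - e\<close> are \<open>\<gamma>\<close> times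
  differences under \<open>A\<close> and \<open>B\<close>, so the bracket is a sum of monotonicity
  terms.\<close>

lemma relaxed_step_norm:
  fixes d e p :: "'g::real_inner"
  shows "(norm (d + (2 * l) *\<^sub>R (p - e)))\<^sup>2
    = (norm d)\<^sup>2 - 4 * l * ((2 *\<^sub>R e - p - d) \<bullet> p + (d - e) \<bullet> e) - 4 * l * (1 - l) * (norm (p - e))\<^sup>2"
  unfolding power2_norm_eq_inner
  by (simp add: inner_add_left inner_add_right inner_diff_left inner_diff_right inner_commute
      algebra_simps)

text \<open>Think of \<open>t\<close> and \<open>t'\<close> as the images of \<open>z\<close> and
  \<open>z'\<close> under a nonexpansive map. The new residual splits into \<open>t' - t\<close>, of
  norm at most \<open>l\<close> times the old residual, and the remaining fraction
  \<open>1 - l\<close> of the old one.\<close>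

lemma relaxed_residual_le:
  fixes z t :: "'g::real_normed_vector"
  assumes l: "0 \<le> l" "l \<le> 1"
    and z': "z' - z = l *\<^sub>R (t - z)"
    and nonexp: "norm (t' - t) \<le> norm (z' - z)"
  shows "norm (t' - z') \<le> norm (t - z)"
proof -
  have "t' - z' = (t' - t) + (1 - l) *\<^sub>R (t - z)"
    using z' by (simp add: algebra_simps)
  then have "norm (t' - z') \<le> norm (t' - t) + (1 - l) * norm (t - z)"
    using l norm_triangle_ineq[of "t' - t" "(1 - l) *\<^sub>R (t - z)"]
    by (metis abs_of_nonneg diff_ge_0_iff_ge norm_scaleR)
  also have "\<dots> \<le> l * norm (t - z) + (1 - l) * norm (t - z)"
    using nonexp z' l by simp
  finally show ?thesis by (simp add: algebra_simps)
qed

text \<open>The multiplier in the optimality condition of the first subproblem is exactly the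
  updated \<open>w'\<close>; the one in the second is the future \<open>wdf\<close>.\<close>

lemma relaxed_admm_optimality:
  fixes A :: "'a::{real_inner, complete_space} \<Rightarrow> 'g::real_inner"
    and B :: "'b::{real_inner, complete_space} \<Rightarrow> 'g"
  assumes A: "bounded_linear A" and B: "bounded_linear B"
    and f: "convex_fun f" "proper_fun f" and g: "convex_fun g" "proper_fun g"
    and step: "admm_step f g A B b \<gamma> l (x, y, w) (x', y', w')"
  shows "w' = w - \<gamma> *\<^sub>R (A x + B y' - b) - (\<gamma> * (2 * l - 1)) *\<^sub>R (A x + B y - b)"
    and "adjoint B w' \<in> subdifferential g y'"
    and "adjoint A (w' - \<gamma> *\<^sub>R (A x' + B y' - b)) \<in> subdifferential f x'"
proof -
  show w': "w' = w - \<gamma> *\<^sub>R (A x + B y' - b) - (\<gamma> * (2 * l - 1)) *\<^sub>R (A x + B y - b)"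
    using step by (simp add: admm_step_def)
  have "is_arg_min (\<lambda>v. g v - ereal (w \<bullet> (B v + (A x - b)))
      + ereal (\<gamma> / 2 * (norm (B v + (A x - b) + (2 * l - 1) *\<^sub>R (A x + B y - b)))\<^sup>2)) (\<lambda>_. True) y'"
    using step by (simp add: admm_step_def add_diff_eq add.commute)
  from augmented_lagrangian_subgradient[OF B g this]
  have "adjoint B (w - \<gamma> *\<^sub>R (B y' + (A x - b) + (2 * l - 1) *\<^sub>R (A x + B y - b)))
      \<in> subdifferential g y'" .
  also have "w - \<gamma> *\<^sub>R (B y' + (A x - b) + (2 * l - 1) *\<^sub>R (A x + B y - b)) = w'"
    unfolding w' by (simp add: algebra_simps)
  finally show "adjoint B w' \<in> subdifferential g y'" .
  have "is_arg_min (\<lambda>u. f u - ereal (w' \<bullet> (A u + (B y' - b)))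
      + ereal (\<gamma> / 2 * (norm (A u + (B y' - b) + 0))\<^sup>2)) (\<lambda>_. True) x'"
    using step by (auto simp add: admm_step_def add_diff_eq)
  from augmented_lagrangian_subgradient[OF A f this]
  show "adjoint A (w' - \<gamma> *\<^sub>R (A x' + B y' - b)) \<in> subdifferential f x'"
    by (simp add: add_diff_eq)
qed

theorem theorem9:
  fixes f :: "'a::{real_inner, complete_space} \<Rightarrow> ereal"
    and g :: "'b::{real_inner, complete_space} \<Rightarrow> ereal"
    and A :: "'a \<Rightarrow> 'g::{real_inner, complete_space}"
    and B :: "'b \<Rightarrow> 'g"
    and b w_init zs ws :: 'g
    and \<gamma> \<mu>f \<mu>g \<beta>f \<beta>g \<alpha>A \<alpha>B :: real
    and lam :: "nat \<Rightarrow> real"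
    and x :: "nat \<Rightarrow> 'a" and y :: "nat \<Rightarrow> 'b"
    and w z wdf wdg :: "nat \<Rightarrow> 'g"
    and xs :: 'a and ys :: 'b
  assumes "bounded_linear A" and "A \<noteq> (\<lambda>_. 0)"
    and "bounded_linear B" and "B \<noteq> (\<lambda>_. 0)"
    and "closed_fun f" and "proper_fun f" and "convex_fun f"
    and "closed_fun g" and "proper_fun g" and "convex_fun g"
    and "\<exists>v. \<exists>p \<in> subdifferential (dual_f f A) v. \<exists>q \<in> subdifferential (dual_g g B b) v. p + q = 0"
    and "\<And>v. subdifferential (dual_f f A) v = A ` subdifferential (conjugate_fun f) (adjoint A v)"
    and "\<And>v. subdifferential (dual_g g B b) v
            = (\<lambda>u. B u - b) ` subdifferential (conjugate_fun g) (adjoint B v)"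
    and "\<mu>f \<ge> 0" and "strongly_convex_fun \<mu>f f"
    and "\<mu>g \<ge> 0" and "strongly_convex_fun \<mu>g g"
    and "\<beta>f \<ge> 0" and "\<beta>f > 0 \<Longrightarrow> has_lipschitz_gradient (1 / \<beta>f) f"
    and "\<beta>g \<ge> 0" and "\<beta>g > 0 \<Longrightarrow> has_lipschitz_gradient (1 / \<beta>g) g"
    and "\<alpha>A \<ge> 0" and "\<And>v. A (adjoint A v) \<bullet> v \<ge> \<alpha>A * (norm v)\<^sup>2"
    and "\<alpha>B \<ge> 0" and "\<And>v. B (adjoint B v) \<bullet> v \<ge> \<alpha>B * (norm v)\<^sup>2"
    and "\<gamma> > 0" and "\<And>j. 0 < lam j \<and> lam j \<le> 1"
    and "relaxed_admm f g A B b \<gamma> lam w_init x y w"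
    and "\<And>k. wdg k = w k"
    and "\<And>k. wdf k = w k - \<gamma> *\<^sub>R (A (x k) + B (y k) - b)"
    and "z 0 = w_init"
    and "\<And>k. z (Suc k) = z k + (2 * lam k) *\<^sub>R (wdf k - wdg k)"
    and "T_PRS \<gamma> (dual_f f A) (dual_g g B b) zs = zs"
    and "ws = prox \<gamma> (dual_g g B b) zs"
    and "adjoint A ws \<in> subdifferential f xs"
    and "adjoint B ws \<in> subdifferential g ys"
    and "B ys - b = (1 / \<gamma>) *\<^sub>R (zs - ws)"
    and "A xs = - (B ys - b)"
  shows "((\<exists>c>0. \<forall>j. lam j \<ge> c) \<longrightarrow>
            (\<lambda>k. MIN i\<in>{0..k}. S_dual \<beta>f \<alpha>A \<mu>f A (wdf i) ws (x i) xs) \<in> o(\<lambda>k. 1 / (real k + 1)) \<and>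
            (\<lambda>k. MIN i\<in>{0..k}. S_dual \<beta>g \<alpha>B \<mu>g B (wdg i) ws (y i) ys) \<in> o(\<lambda>k. 1 / (real k + 1)))
       \<and> (\<forall>k. max (\<beta>f * \<alpha>A * (norm (erg_avg lam wdf k - ws))\<^sup>2)
                  (\<mu>f / (onorm A)\<^sup>2 * (norm (A (erg_avg lam x k) - A xs))\<^sup>2)
            + max (\<beta>g * \<alpha>B * (norm (erg_avg lam wdg k - ws))\<^sup>2)
                  (\<mu>g / (onorm B)\<^sup>2 * (norm (B (erg_avg lam y k) - B ys))\<^sup>2)
            \<le> (norm (z 0 - zs))\<^sup>2 / (4 * \<gamma> * (\<Sum>i=0..k. lam i)))
       \<and> ((INF j. lam j * (1 - lam j)) > 0 \<longrightarrow>
            (\<lambda>k. S_dual \<beta>f \<alpha>A \<mu>f A (wdf k) ws (x k) xs + S_dual \<beta>g \<alpha>B \<mu>g B (wdg k) ws (y k) ys)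
              \<in> o(\<lambda>k. 1 / sqrt (real k + 1)))"
proof -
  note A = assms(1,2) and B = assms(3,4) and f = assms(7,6) and g = assms(10,9)
    and \<mu>f = assms(14,15) and \<mu>g = assms(16,17) and \<beta>f = assms(18,19) and \<beta>g = assms(20,21)
    and \<gamma> = assms(26) and lam = assms(27) and admm = assms(28) and wdg = assms(29)
    and wdf = assms(30) and z0 = assms(31) and zSuc = assms(32)
  interpret A: bounded_linear A by fact
  interpret B: bounded_linear B by fact
  have lam0: "0 < lam j" and lam1: "lam j \<le> 1" for j using lam by auto

  \<comment> \<open>Optimality of the iterates and the governing sequence\<close>
  have first: "admm_step f g A B b \<gamma> (1 / 2) (0, 0, w_init) (x 0, y 0, w 0)"
    and step: "\<And>k. admm_step f g A B b \<gamma> (lam k) (x k, y k, w k) (x (Suc k), y (Suc k), w (Suc k))"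
    using admm by (auto simp: relaxed_admm_def)
  note opt0 = relaxed_admm_optimality[OF A(1) B(1) f g first]
    and optS = relaxed_admm_optimality[OF A(1) B(1) f g step]
  \<comment> \<open>Index 0 is produced by the initial step with relaxation 1/2, index
    \<open>Suc k\<close> by the step with \<open>lam k\<close>; hence the case split.\<close>
  have sub_g: "adjoint B (wdg k) \<in> subdifferential g (y k)" for k
    using opt0 optS by (cases k) (auto simp: wdg)
  have sub_f: "adjoint A (wdf k) \<in> subdifferential f (x k)" for k
    using opt0 optS by (cases k) (auto simp: wdf)
  \<comment> \<open>At the start \<open>2 * l - 1\<close> and \<open>A 0\<close> vanish. In the
    induction step the relaxation terms and \<open>B (y k)\<close> cancel between the updates of
    \<open>z\<close> and \<open>w\<close>.\<close>
  have zw: "z k - wdg k = \<gamma> *\<^sub>R (B (y k) - b)" for k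
  proof (induction k)
    case 0
    then show ?case using opt0(1) by (simp add: wdg z0 A.zero algebra_simps)
  next
    case (Suc k)
    have z: "z k = w k + \<gamma> *\<^sub>R (B (y k) - b)" using Suc by (simp add: wdg algebra_simps)
    show ?case
      unfolding wdg zSuc z wdf optS(1)[of k] by (simp add: algebra_simps)
  qed
  have zws: "zs - ws = \<gamma> *\<^sub>R (B ys - b)"
    using assms(37) \<gamma> by simp
  have zwf: "2 *\<^sub>R wdg k - wdf k - z k = \<gamma> *\<^sub>R A (x k)" for k
    using zw[of k] by (simp add: wdf wdg algebra_simps scaleR_2)
  \<comment> \<open>The counterpart of \<open>zwf\<close> at the fixed point, where both dual points
    equal \<open>ws\<close>; it is left unsimplified so that the two can be subtracted.\<close>
  have zwfs: "2 *\<^sub>R ws - ws - zs = \<gamma> *\<^sub>R A xs"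
    using zws unfolding assms(38) by (simp add: algebra_simps scaleR_2)

  \<comment> \<open>Descent of the distance to the fixed point\<close>
  define Sf where "Sf k = S_dual \<beta>f \<alpha>A \<mu>f A (wdf k) ws (x k) xs" for k
  define Sg where "Sg k = S_dual \<beta>g \<alpha>B \<mu>g B (wdg k) ws (y k) ys" for k
  define d where "d k = z k - zs" for k
  define q where "q k = wdf k - wdg k" for k
  define I where "I k = (A (x k) - A xs) \<bullet> (wdf k - ws) + (B (y k) - B ys) \<bullet> (wdg k - ws)" for k
  have Sf0: "0 \<le> Sf k" and Sg0: "0 \<le> Sg k" for k
    unfolding Sf_def Sg_def using \<mu>f(1) \<mu>g(1) by (simp_all add: S_dual_nonneg)
  have SI: "2 * (Sf k + Sg k) \<le> I k" for k
    using S_dual_le_inner[OF A \<mu>f \<beta>f assms(23) sub_f assms(35), of k]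
      S_dual_le_inner[OF B \<mu>g \<beta>g assms(25) sub_g assms(36), of k]
    by (simp add: Sf_def Sg_def I_def)

  \<comment> \<open>Kept for arbitrary \<open>l\<close>: the value \<open>lam k\<close> gives the
    descent, and \<open>l = 1\<close> gives the formula for \<open>I k\<close> in the last
    rate.\<close>
  have relax: "(norm (d k + (2 * l) *\<^sub>R q k))\<^sup>2
      = (norm (d k))\<^sup>2 - 4 * l * (\<gamma> * I k) - 4 * l * (1 - l) * (norm (q k))\<^sup>2" for k l
  proof -
    have "d k - (wdg k - ws) = (z k - wdg k) - (zs - ws)" by (simp add: d_def)
    also have "\<dots> = \<gamma> *\<^sub>R (B (y k) - B ys)" unfolding zw zws by (simp add: algebra_simps)
    finally have B: "d k - (wdg k - ws) = \<gamma> *\<^sub>R (B (y k) - B ys)" .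
    have "2 *\<^sub>R (wdg k - ws) - (wdf k - ws) - d k
        = (2 *\<^sub>R wdg k - wdf k - z k) - (2 *\<^sub>R ws - ws - zs)"
      by (simp add: d_def algebra_simps)
    also have "\<dots> = \<gamma> *\<^sub>R (A (x k) - A xs)" unfolding zwf zwfs by (simp add: algebra_simps)
    finally have A: "2 *\<^sub>R (wdg k - ws) - (wdf k - ws) - d k = \<gamma> *\<^sub>R (A (x k) - A xs)" .
    have q: "(wdf k - ws) - (wdg k - ws) = q k" by (simp add: q_def)
    show ?thesis
      using relaxed_step_norm[of "d k" l "wdf k - ws" "wdg k - ws"] unfolding A B q
      by (simp add: I_def algebra_simps)
  qed
  have dSuc: "d (Suc k) = d k + (2 * lam k) *\<^sub>R q k" for k
    by (simp add: d_def q_def zSuc)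
  have descent: "(norm (d (Suc k)))\<^sup>2 + 8 * \<gamma> * (lam k * (Sf k + Sg k))
      + 4 * (lam k * (1 - lam k)) * (norm (q k))\<^sup>2 \<le> (norm (d k))\<^sup>2" for k
  proof -
    have "4 * lam k * (\<gamma> * (2 * (Sf k + Sg k))) \<le> 4 * lam k * (\<gamma> * I k)"
      using SI[of k] lam0[of k] \<gamma> by (intro mult_left_mono) auto
    then show ?thesis unfolding dSuc relax by (simp add: algebra_simps)
  qed
  have nonneg: "0 \<le> 8 * \<gamma> * (lam k * (Sf k + Sg k))" "0 \<le> 4 * (lam k * (1 - lam k)) * (norm (q k))\<^sup>2" for k
    using \<gamma> lam0[of k] lam1[of k] Sf0[of k] Sg0[of k] by auto
  \<comment> \<open>Telescoping \<open>descent\<close>. The term \<open>(norm (d n))\<^sup>2\<close>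
    is retained because it also bounds the distances uniformly later on.\<close>
  have partial: "(norm (d n))\<^sup>2 + (\<Sum>i<n. 8 * \<gamma> * (lam i * (Sf i + Sg i))
      + 4 * (lam i * (1 - lam i)) * (norm (q i))\<^sup>2) \<le> (norm (d 0))\<^sup>2" for n
  proof (induction n)
    case (Suc n)
    then show ?case using descent[of n] by simp
  qed simp
  have summable: "summable (\<lambda>i. 8 * \<gamma> * (lam i * (Sf i + Sg i))
      + 4 * (lam i * (1 - lam i)) * (norm (q i))\<^sup>2)"
  proof (rule summableI_nonneg_bounded)
    show "(\<Sum>i<n. 8 * \<gamma> * (lam i * (Sf i + Sg i)) + 4 * (lam i * (1 - lam i)) * (norm (q i))\<^sup>2)
        \<le> (norm (d 0))\<^sup>2" for n
      using partial[of n] zero_le_power2[of "norm (d n)"] by linarith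
  qed (use nonneg add_nonneg_nonneg in blast)

  \<comment> \<open>Best-iterate rate\<close>
  have best: "(\<lambda>k. MIN i\<in>{0..k}. Sf i) \<in> o(\<lambda>k. 1 / (real k + 1))
      \<and> (\<lambda>k. MIN i\<in>{0..k}. Sg i) \<in> o(\<lambda>k. 1 / (real k + 1))"
    if c: "c > 0" "\<forall>j. lam j \<ge> c" for c
  proof -
    have bound: "8 * \<gamma> * c * (Sf i + Sg i)
        \<le> 8 * \<gamma> * (lam i * (Sf i + Sg i)) + 4 * (lam i * (1 - lam i)) * (norm (q i))\<^sup>2" for i
    proof -
      have "8 * \<gamma> * (c * (Sf i + Sg i)) \<le> 8 * \<gamma> * (lam i * (Sf i + Sg i))"
        using \<gamma> c Sf0[of i] Sg0[of i] by (intro mult_left_mono mult_right_mono) auto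
      then show ?thesis using nonneg(2)[of i] by (simp add: mult.assoc)
    qed
    have "summable (\<lambda>i. 8 * \<gamma> * c * (Sf i + Sg i))"
      using bound \<gamma> c Sf0 Sg0 by (intro summable_comparison_test'[OF summable]) simp
    then have sum: "summable (\<lambda>i. Sf i + Sg i)"
      using \<gamma> c by (simp add: summable_cmult_iff)
    have "summable Sf" "summable Sg"
      using Sf0 Sg0 by (auto intro!: summable_comparison_test'[OF sum])
    then show ?thesis using Sf0 Sg0 by (simp add: Min_summable_smallo)
  qed

  \<comment> \<open>Ergodic rate\<close>
  have ergodic: "max (\<beta>f * \<alpha>A * (norm (erg_avg lam wdf k - ws))\<^sup>2)
        (\<mu>f / (onorm A)\<^sup>2 * (norm (A (erg_avg lam x k) - A xs))\<^sup>2)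
      + max (\<beta>g * \<alpha>B * (norm (erg_avg lam wdg k - ws))\<^sup>2)
        (\<mu>g / (onorm B)\<^sup>2 * (norm (B (erg_avg lam y k) - B ys))\<^sup>2)
      \<le> (norm (z 0 - zs))\<^sup>2 / (4 * \<gamma> * (\<Sum>i=0..k. lam i))" (is "?L \<le> _") for k
  proof -
    let ?\<Lambda> = "\<Sum>i=0..k. lam i"
    have pos: "?\<Lambda> > 0" using lam0 by (intro sum_pos) auto
    have "(\<Sum>i<Suc k. 8 * \<gamma> * (lam i * (Sf i + Sg i)))
        \<le> (\<Sum>i<Suc k. 8 * \<gamma> * (lam i * (Sf i + Sg i)) + 4 * (lam i * (1 - lam i)) * (norm (q i))\<^sup>2)"
      using nonneg by (intro sum_mono) simp
    also have "\<dots> \<le> (norm (z 0 - zs))\<^sup>2"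
      using partial[of "Suc k"] zero_le_power2[of "norm (d (Suc k))"] unfolding d_def by linarith
    \<comment> \<open>The constant 8 is split as 4 * 2 to match the doubled \<open>S_dual\<close> in
      \<open>max_erg_avg_le\<close>.\<close>
    finally have total: "4 * \<gamma> * (\<Sum>i=0..k. lam i * (2 * Sf i) + lam i * (2 * Sg i)) \<le> (norm (z 0 - zs))\<^sup>2"
      by (simp add: sum_distrib_left lessThan_Suc_atMost atMost_atLeast0 algebra_simps)
    have "?L \<le> (\<Sum>i=0..k. lam i * (2 * Sf i)) / ?\<Lambda> + (\<Sum>i=0..k. lam i * (2 * Sg i)) / ?\<Lambda>"
      unfolding Sf_def Sg_def
      using A(1) B(1) lam0 \<beta>f(1) \<beta>g(1) \<mu>f(1) \<mu>g(1) assms(22,24)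
      by (intro add_mono max_erg_avg_le)
    also have "\<dots> = (\<Sum>i=0..k. lam i * (2 * Sf i) + lam i * (2 * Sg i)) / ?\<Lambda>"
      by (simp add: sum.distrib add_divide_distrib)
    also have "\<dots> \<le> (norm (z 0 - zs))\<^sup>2 / (4 * \<gamma> * ?\<Lambda>)"
      using total pos \<gamma> by (simp add: field_simps)
    finally show ?thesis .
  qed

  \<comment> \<open>Monotone residuals and the rate of the last iterate\<close>
  have residual_le: "norm (q (Suc k)) \<le> norm (q k)" for k
  proof -
    define dz where "dz = z (Suc k) - z k"
    define dp where "dp = wdf (Suc k) - wdf k"
    define de where "de = wdg (Suc k) - wdg k"
    have "dz - de = (z (Suc k) - wdg (Suc k)) - (z k - wdg k)" by (simp add: dz_def de_def)
    also have "\<dots> = \<gamma> *\<^sub>R (B (y (Suc k)) - B (y k))" unfolding zw by (simp add: algebra_simps)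
    finally have B': "dz - de = \<gamma> *\<^sub>R (B (y (Suc k)) - B (y k))" .
    have "2 *\<^sub>R de - dp - dz
        = (2 *\<^sub>R wdg (Suc k) - wdf (Suc k) - z (Suc k)) - (2 *\<^sub>R wdg k - wdf k - z k)"
      by (simp add: dz_def de_def dp_def algebra_simps)
    also have "\<dots> = \<gamma> *\<^sub>R (A (x (Suc k)) - A (x k))" unfolding zwf by (simp add: algebra_simps)
    finally have A': "2 *\<^sub>R de - dp - dz = \<gamma> *\<^sub>R (A (x (Suc k)) - A (x k))" .
    \<comment> \<open>The regularity bound between consecutive iterates is used only for its sign,
      that is, for monotonicity of the subdifferential.\<close>
    have "0 \<le> (A (x (Suc k)) - A (x k)) \<bullet> dp"
      using S_dual_le_inner[OF A \<mu>f \<beta>f assms(23) sub_f sub_f, of "Suc k" k] \<mu>f(1) unfolding dp_def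
      by (meson S_dual_nonneg mult_nonneg_nonneg order_trans zero_le_numeral)
    moreover have "0 \<le> (B (y (Suc k)) - B (y k)) \<bullet> de"
      using S_dual_le_inner[OF B \<mu>g \<beta>g assms(25) sub_g sub_g, of "Suc k" k] \<mu>g(1) unfolding de_def
      by (meson S_dual_nonneg mult_nonneg_nonneg order_trans zero_le_numeral)
    \<comment> \<open>With \<open>l = 1\<close> the residual term disappears. Here
      \<open>z k + 2 *\<^sub>R q k\<close> stands for the Peaceman-Rachford image of
      \<open>z k\<close>, so this is nonexpansiveness along the iterates.\<close>
    ultimately have "(norm (dz + 2 *\<^sub>R (dp - de)))\<^sup>2 \<le> (norm dz)\<^sup>2"
      using relaxed_step_norm[of dz 1 dp de] \<gamma> unfolding A' B' by (simp flip: distrib_left)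
    then have nonexp: "norm ((z (Suc k) + 2 *\<^sub>R q (Suc k)) - (z k + 2 *\<^sub>R q k)) \<le> norm (z (Suc k) - z k)"
      by (simp add: power2_le_iff_abs_le dz_def dp_def de_def q_def algebra_simps)
    have "norm ((z (Suc k) + 2 *\<^sub>R q (Suc k)) - z (Suc k)) \<le> norm ((z k + 2 *\<^sub>R q k) - z k)"
      by (rule relaxed_residual_le[OF _ _ _ nonexp, of "lam k"])
        (use lam0[of k] lam1[of k] in \<open>auto simp: zSuc q_def\<close>)
    then show ?thesis by simp
  qed

  have general: "(\<lambda>k. Sf k + Sg k) \<in> o(\<lambda>k. 1 / sqrt (real k + 1))"
    if pos: "(INF j. lam j * (1 - lam j)) > 0"
  proof -
    define \<epsilon> where "\<epsilon> = (INF j. lam j * (1 - lam j))"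
    have \<epsilon>: "\<epsilon> > 0" using pos by (simp add: \<epsilon>_def)
    have bdd: "bdd_below (range (\<lambda>j. lam j * (1 - lam j)))"
      using lam0 lam1 by (intro bdd_belowI[of _ 0]) (auto intro!: mult_nonneg_nonneg simp: less_imp_le)
    have \<epsilon>_le: "\<epsilon> \<le> lam j * (1 - lam j)" for j
      unfolding \<epsilon>_def using bdd by (rule cINF_lower) simp
    have bound: "4 * \<epsilon> * (norm (q i))\<^sup>2
        \<le> 8 * \<gamma> * (lam i * (Sf i + Sg i)) + 4 * (lam i * (1 - lam i)) * (norm (q i))\<^sup>2" for i
    proof -
      have "4 * \<epsilon> * (norm (q i))\<^sup>2 \<le> 4 * (lam i * (1 - lam i)) * (norm (q i))\<^sup>2"
        using \<epsilon>_le[of i] by (intro mult_right_mono) auto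
      then show ?thesis using nonneg(1)[of i] by linarith
    qed
    have "summable (\<lambda>i. 4 * \<epsilon> * (norm (q i))\<^sup>2)"
      using bound \<epsilon> by (intro summable_comparison_test'[OF summable]) simp
    then have "summable (\<lambda>i. (norm (q i))\<^sup>2)"
      using \<epsilon> by (simp add: summable_cmult_iff)
    then have "(\<lambda>k. (norm (q k))\<^sup>2) \<in> o(\<lambda>k. 1 / (real k + 1))"
      using residual_le by (intro decseq_summable_smallo) (auto simp: decseq_Suc_iff power_mono)
    then have "((\<lambda>k. (norm (q k))\<^sup>2 / (1 / (real k + 1))) \<longlonglongrightarrow> 0)"
      by (rule smalloD_tendsto)
    \<comment> \<open>Square roots turn the rate for the squared residual into o(1/sqrt(k+1)) for
      the residual.\<close>
    from tendsto_real_sqrt[OF this]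
    have "(\<lambda>k. norm (q k) * sqrt (real k + 1)) \<longlonglongrightarrow> 0"
      by (simp add: real_sqrt_mult)
    then have lim: "(\<lambda>k. norm (d 0) / (2 * \<gamma>) * (norm (q k) * sqrt (real k + 1))) \<longlonglongrightarrow> 0"
      by (rule tendsto_mult_right_zero)
    \<comment> \<open>Linear rather than quadratic in the residual, which is why the rate carries a
      square root.\<close>
    have S_le: "Sf k + Sg k \<le> norm (d 0) / (2 * \<gamma>) * norm (q k)" for k
    proof -
      have "(\<Sum>i<k. 8 * \<gamma> * (lam i * (Sf i + Sg i)) + 4 * (lam i * (1 - lam i)) * (norm (q i))\<^sup>2) \<ge> 0"
        using nonneg by (intro sum_nonneg) (simp add: add_nonneg_nonneg)
      then have "(norm (d k))\<^sup>2 \<le> (norm (d 0))\<^sup>2" using partial[of k] by linarith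
      then have d: "norm (d k) \<le> norm (d 0)" by (simp add: power2_le_iff_abs_le)
      \<comment> \<open>Equating this direct expansion with \<open>relax\<close> at
        \<open>l = 1\<close> expresses \<open>I k\<close> through \<open>d k\<close> and
        \<open>q k\<close>, ready for Cauchy-Schwarz.\<close>
      have "(norm (d k + 2 *\<^sub>R q k))\<^sup>2 = (norm (d k))\<^sup>2 + 4 * (d k \<bullet> q k) + 4 * (norm (q k))\<^sup>2"
        by (simp add: power2_norm_eq_inner inner_add_left inner_add_right inner_commute)
      then have "\<gamma> * I k = - (d k \<bullet> q k) - (norm (q k))\<^sup>2"
        using relax[of k 1] by simp
      also have "\<dots> \<le> norm (d k) * norm (q k)"
        using Cauchy_Schwarz_ineq2[of "d k" "q k"] zero_le_power2[of "norm (q k)"] by linarith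
      also have "\<dots> \<le> norm (d 0) * norm (q k)" using d by (rule mult_right_mono) simp
      finally have "\<gamma> * (2 * (Sf k + Sg k)) \<le> norm (d 0) * norm (q k)"
        using mult_left_mono[OF SI[of k], of \<gamma>] \<gamma> by linarith
      then show ?thesis using \<gamma> by (simp add: field_simps)
    qed
    have "(\<lambda>k. (Sf k + Sg k) * sqrt (real k + 1)) \<longlonglongrightarrow> 0"
    proof (rule tendsto_sandwich[OF _ _ tendsto_const lim])
      show "\<forall>\<^sub>F k in sequentially. 0 \<le> (Sf k + Sg k) * sqrt (real k + 1)"
        using Sf0 Sg0 by simp
      show "\<forall>\<^sub>F k in sequentially. (Sf k + Sg k) * sqrt (real k + 1)
          \<le> norm (d 0) / (2 * \<gamma>) * (norm (q k) * sqrt (real k + 1))"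
        using mult_right_mono[OF S_le] by (simp add: mult.assoc)
    qed
    then show ?thesis by (intro smalloI_tendsto) auto
  qed
  show ?thesis
    using best ergodic general unfolding Sf_def Sg_def by blast
qed

end
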